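(* Let $f_1,\dots,f_m\in C^1(\mathbb{R}^n)$ have gradients that are Lipschitz on $\mathbb{R}^n$ with constants $L_i\ge0$, and let $f(x)=\max_{1\le i\le m}f_i(x)$. Let $\tau_j\downarrow0$ (with $\tau_j>0$) and $\varepsilon_j\downarrow0$, and let $z^j=(x^j,t^j)\in\mathbb{R}^n\times\mathbb{R}$ satisfy $$\|\nabla\Phi_{\tau_j}(z^j)\|\le\varepsilon_j\quad\text{for all }j.$$ Suppose that $(z^j)$ has an accumulation point $z^\star=(x^\star,t^\star)$. Then $$0\in\partial_Cf(x^\star).$$
   Context: Hyperbolic smoothing: $\phi_\tau(r)=\frac{r+\sqrt{r^2+\tau^2}}{2}$ and $\Phi_\tau(x,t)=t+\sum_{i=1}^m\phi_\tau(f_i(x)-t)$ for $(x,t)\in\mathbb{R}^{n+1}$, $\tau>0$. $\partial_Cf$ is the Clarke subdifferential; for this finite maximum of $C^1$ functions it equals $\partial_Cf(x)=\operatorname{co}\{\nabla f_i(x):i\in I(x)\}$, where $I(x)=\{i:f_i(x)=f(x)\}$ and $\operatorname{co}$ is the convex hull. *)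

theory Defs
  imports "HOL-Analysis.Analysis"
begin

text \<open>The value is meaningful only where the function is differentiable.\<close>

definition grad :: "('a::real_inner \<Rightarrow> real) \<Rightarrow> 'a \<Rightarrow> 'a" where
  "grad f x = (THE g. GDERIV f x :> g)"

lemma grad_eq:
  assumes "GDERIV f x :> g"
  shows "grad f x = g"
  unfolding grad_def
proof (rule the_equality)
  fix h assume "GDERIV f x :> h"
  from has_derivative_unique[OF this[unfolded gderiv_def] assms[unfolded gderiv_def]]
  have "v \<bullet> h = v \<bullet> g" for v by (rule fun_cong)
  then show "h = g" by (rule iffD1[OF vector_eq_ldot, OF allI])
qed (rule assms)

definition C1_fun :: "('a::real_inner \<Rightarrow> real) \<Rightarrow> bool" where
  "C1_fun f \<longleftrightarrow> (\<forall>x. f differentiable (at x)) \<and> continuous_on UNIV (grad f)"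

text \<open>
  Clarke's generalized directional derivative is the limsup of the difference quotient
  \<open>(f (y + s v) - f y) / s\<close> as \<open>y\<close> tends to \<open>x\<close> (with \<open>y = x\<close> allowed, hence \<open>nhds x\<close>)
  and \<open>s\<close> decreases to \<open>0\<close>. For locally Lipschitz \<open>f\<close> it is finite.
\<close>

definition clarke_dd :: "('a::real_inner \<Rightarrow> real) \<Rightarrow> 'a \<Rightarrow> 'a \<Rightarrow> ereal" where
  "clarke_dd f x v =
     Limsup (nhds x \<times>\<^sub>F at_right (0::real)) (\<lambda>(y, s). ereal ((f (y + s *\<^sub>R v) - f y) / s))"

definition clarke_subdiff :: "('a::real_inner \<Rightarrow> real) \<Rightarrow> 'a \<Rightarrow> 'a set" where
  "clarke_subdiff f x = {g. \<forall>v. ereal (g \<bullet> v) \<le> clarke_dd f x v}"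

definition phi :: "real \<Rightarrow> real \<Rightarrow> real" where
  "phi \<tau> r = (r + sqrt (r\<^sup>2 + \<tau>\<^sup>2)) / 2"

definition Phi :: "nat \<Rightarrow> (nat \<Rightarrow> 'a \<Rightarrow> real) \<Rightarrow> real \<Rightarrow> 'a \<times> real \<Rightarrow> real" where
  "Phi m f \<tau> = (\<lambda>(x, t). t + (\<Sum>i=1..m. phi \<tau> (f i x - t)))"

text \<open>Every neighbourhood of the point contains terms of the sequence with arbitrarily large index.\<close>

definition accumulation_point :: "(nat \<Rightarrow> 'a::topological_space) \<Rightarrow> 'a \<Rightarrow> bool" where
  "accumulation_point z a \<longleftrightarrow> (\<forall>U. open U \<and> a \<in> U \<longrightarrow> (\<exists>\<^sub>F j in sequentially. z j \<in> U))"

end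

theory Submission
  imports Defs
begin

text \<open>
  The derivative \<open>phi_slope \<tau>\<close> of \<open>phi \<tau>\<close> takes values in \<open>[0, 1]\<close>, so the gradient of \<open>Phi\<close>
  at \<open>(x, t)\<close> is \<open>(\<Sum>i. w\<^sub>i \<nabla>f\<^sub>i x, 1 - \<Sum>i. w\<^sub>i)\<close> with the weights
  \<open>w\<^sub>i = phi_slope \<tau> (f\<^sub>i x - t)\<close>. Near-stationarity therefore says that the weights nearly form a
  convex combination and that this combination of the gradients is nearly zero
  (\<open>GDERIV_Phi\<close>).

  As \<open>\<tau>\<close> tends to \<open>0\<close>, the slope tends to the Heaviside step: a function whose limit
  value is strictly below the limit level loses its weight, one strictly above it gets weight \<open>1\<close>. Because the weights
  sum to \<open>1\<close> in the limit, the limit level can neither exceed the maximum nor have more than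
  one function above it; in every case only the functions that attain the maximum
  keep weight (\<open>inactive_weight_tendsto_0\<close>).

  For each direction \<open>v\<close>, a vanishing average of the slopes \<open>\<nabla>f\<^sub>i x \<bullet> v\<close> over the active functions
  forces one of these slopes to be nonnegative
  (\<open>nonneg_limit_of_vanishing_average\<close>), and each active slope is a lower bound for the generalized
  directional derivative of the maximum (\<open>active_slope_le_clarke_dd\<close>). The active function may
  depend on \<open>v\<close>; this is why the argument can work with the weights as they are, instead of passing
  to a subsequence along which they converge.
\<close>

section \<open>Gradients\<close>

lemma GDERIV_grad:
  fixes f :: "'a::euclidean_space \<Rightarrow> real"
  assumes "f differentiable (at x)"
  shows "GDERIV f x :> grad f x"
proof -
  obtain D where D: "(f has_derivative D) (at x)"
    using assms by (auto simp: differentiable_def)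
  \<comment> \<open>The adjoint of a functional, evaluated at \<open>1\<close>, is its Riesz representative.\<close>
  define g where "g = adjoint D 1"
  have "D h = h \<bullet> g" for h
    using adjoint_works[OF has_derivative_linear[OF D], of h 1] by (simp add: g_def)
  then have "D = (\<lambda>h. h \<bullet> g)"
    by (rule ext)
  with D have "GDERIV f x :> g"
    by (simp add: gderiv_def)
  then show ?thesis
    by (simp add: grad_eq)
qed

definition phi_slope :: "real \<Rightarrow> real \<Rightarrow> real" where
  "phi_slope \<tau> r = (1 + r / sqrt (r\<^sup>2 + \<tau>\<^sup>2)) / 2"

lemma phi_has_real_derivative:
  assumes "\<tau> \<noteq> 0"
  shows "(phi \<tau> has_real_derivative phi_slope \<tau> r) (at r)"
proof -
  have pos: "0 < r\<^sup>2 + \<tau>\<^sup>2"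
    using assms by (simp add: add_nonneg_pos)
  have "((\<lambda>r. r\<^sup>2 + \<tau>\<^sup>2) has_real_derivative 2 * r) (at r)"
    by (auto intro!: derivative_eq_intros)
  from DERIV_chain2[OF DERIV_real_sqrt[OF pos] this]
  have "((\<lambda>r. sqrt (r\<^sup>2 + \<tau>\<^sup>2)) has_real_derivative r / sqrt (r\<^sup>2 + \<tau>\<^sup>2)) (at r)"
    by (rule DERIV_cong) (simp add: inverse_eq_divide)
  then show ?thesis
    unfolding phi_def[abs_def] phi_slope_def
    by (intro DERIV_cdivide DERIV_add DERIV_ident)
qed

lemma phi_slope_bounds: "0 \<le> phi_slope \<tau> r" "phi_slope \<tau> r \<le> 1"
proof -
  have "\<bar>r\<bar> \<le> sqrt (r\<^sup>2 + \<tau>\<^sup>2)"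
    by (rule real_le_rsqrt) simp
  then have "\<bar>r / sqrt (r\<^sup>2 + \<tau>\<^sup>2)\<bar> \<le> 1"
    by (auto simp: divide_le_eq_1 sum_power2_gt_zero_iff)
  then have "- 1 \<le> r / sqrt (r\<^sup>2 + \<tau>\<^sup>2) \<and> r / sqrt (r\<^sup>2 + \<tau>\<^sup>2) \<le> 1"
    by linarith
  then show "0 \<le> phi_slope \<tau> r" "phi_slope \<tau> r \<le> 1"
    unfolding phi_slope_def by simp_all
qed

lemma phi_slope_tendsto:
  assumes "(\<tau> \<longlongrightarrow> 0) F" "(r \<longlongrightarrow> a) F" "a \<noteq> 0"
  shows "((\<lambda>j. phi_slope (\<tau> j) (r j)) \<longlongrightarrow> (if a > 0 then 1 else 0)) F"
proof -
  have "((\<lambda>j. phi_slope (\<tau> j) (r j)) \<longlongrightarrow> (1 + a / sqrt (a\<^sup>2 + 0\<^sup>2)) / 2) F"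
    unfolding phi_slope_def using assms by (intro tendsto_intros) auto
  moreover have "(1 + a / sqrt (a\<^sup>2 + 0\<^sup>2)) / 2 = (if a > 0 then 1 else 0)"
    using assms(3) by simp
  ultimately show ?thesis
    by (simp only:)
qed

lemma GDERIV_Phi:
  fixes f :: "nat \<Rightarrow> 'a::euclidean_space \<Rightarrow> real"
  assumes "\<And>i. i \<in> {1..m} \<Longrightarrow> f i differentiable (at x)" and "\<tau> \<noteq> 0"
  shows "GDERIV (Phi m f \<tau>) (x, t) :>
    (\<Sum>i=1..m. phi_slope \<tau> (f i x - t) *\<^sub>R grad (f i) x, 1 - (\<Sum>i=1..m. phi_slope \<tau> (f i x - t)))"
proof -
  let ?w = "\<lambda>i. phi_slope \<tau> (f i x - t)"
  have summand: "((\<lambda>p. phi \<tau> (f i (fst p) - snd p)) has_derivative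
      (\<lambda>h. ?w i * (fst h \<bullet> grad (f i) x - snd h))) (at (x, t))"
    if i: "i \<in> {1..m}" for i
  proof -
    have fi: "(f i has_derivative (\<lambda>h. h \<bullet> grad (f i) x)) (at (fst (x, t)))"
      using GDERIV_grad[OF assms(1)[OF i]] by (simp add: gderiv_def)
    have "((\<lambda>p. f i (fst p)) has_derivative (\<lambda>h. fst h \<bullet> grad (f i) x)) (at (x, t))"
      by (rule has_derivative_compose[where f = fst and g = "f i", OF _ fi])
        (intro has_derivative_fst has_derivative_ident)
    then have "((\<lambda>p. f i (fst p) - snd p) has_derivative
        (\<lambda>h. fst h \<bullet> grad (f i) x - snd h)) (at (x, t))"
      by (intro has_derivative_diff has_derivative_snd has_derivative_ident)
    moreover have "(phi \<tau> has_derivative (*) (?w i)) (at (f i (fst (x, t)) - snd (x, t)))"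
      using phi_has_real_derivative[OF assms(2)] by (simp add: has_field_derivative_def)
    ultimately show ?thesis
      by (rule has_derivative_compose)
  qed
  have Phi: "Phi m f \<tau> = (\<lambda>p. snd p + (\<Sum>i=1..m. phi \<tau> (f i (fst p) - snd p)))"
    by (simp add: Phi_def case_prod_unfold)
  have "(Phi m f \<tau> has_derivative
      (\<lambda>h. snd h + (\<Sum>i=1..m. ?w i * (fst h \<bullet> grad (f i) x - snd h)))) (at (x, t))"
    unfolding Phi
    by (intro has_derivative_add has_derivative_sum summand has_derivative_snd has_derivative_ident)
  then show ?thesis
    unfolding gderiv_def
    by (rule has_derivative_eq_rhs)
      (auto simp: fun_eq_iff inner_sum_right right_diff_distrib sum_subtractf
        sum_distrib_left mult.commute)
qed

section \<open>Limits of the weights\<close>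

text \<open>
  The three positions of the limit level \<open>b\<close> relative to the maximum of the limit values are
  different: if \<open>b\<close> is above the maximum, all weights would vanish and could not sum to \<open>1\<close>;
  if it is equal to the maximum, every inactive value lies below the level;
  if it is below, a maximizer alone already takes the whole mass \<open>1\<close>.
\<close>

lemma inactive_weight_tendsto_0:
  fixes r :: "'i \<Rightarrow> 'j \<Rightarrow> real"
  assumes "F \<noteq> bot" and A: "finite A" and \<tau>: "(\<tau> \<longlongrightarrow> 0) F"
    and r: "\<And>i. i \<in> A \<Longrightarrow> ((\<lambda>j. r i j - t j) \<longlongrightarrow> a i - b) F"
    and mass: "((\<lambda>j. \<Sum>i\<in>A. phi_slope (\<tau> j) (r i j - t j)) \<longlongrightarrow> 1) F"
    and k: "k \<in> A" "a k < Max (a ` A)"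
  shows "((\<lambda>j. phi_slope (\<tau> j) (r k j - t j)) \<longlongrightarrow> 0) F"
proof -
  let ?w = "\<lambda>i j. phi_slope (\<tau> j) (r i j - t j)"
  have below: "(?w i \<longlongrightarrow> 0) F" if "i \<in> A" "a i < b" for i
    using phi_slope_tendsto[OF \<tau> r[OF that(1)]] that by simp
  have "Max (a ` A) \<in> a ` A"
    using A k by (intro Max_in) auto
  then obtain p where p: "p \<in> A" "a p = Max (a ` A)"
    by (metis imageE)
  have max: "a i \<le> a p" if "i \<in> A" for i
    using A p that by simp
  consider "a p < b" | "a p = b" | "a p > b"
    by linarith
  then show ?thesis
  proof cases
    case 1
    have "((\<lambda>j. \<Sum>i\<in>A. ?w i j) \<longlongrightarrow> (\<Sum>i\<in>A. 0)) F"
      by (intro tendsto_sum below) (use 1 max in fastforce)+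
    from tendsto_unique[OF \<open>F \<noteq> bot\<close> this mass] show ?thesis
      by simp
  next
    case 2
    then show ?thesis
      using below k p by simp
  next
    case 3
    have "(?w p \<longlongrightarrow> 1) F"
      using phi_slope_tendsto[OF \<tau> r[OF p(1)]] 3 by simp
    from tendsto_diff[OF mass this]
    have rest: "((\<lambda>j. (\<Sum>i\<in>A. ?w i j) - ?w p j) \<longlongrightarrow> 0) F"
      by simp
    have "?w k j \<le> (\<Sum>i\<in>A. ?w i j) - ?w p j" for j
    proof -
      have "k \<in> A - {p}"
        using k p by auto
      then have "?w k j \<le> (\<Sum>i\<in>A - {p}. ?w i j)"
        using A by (intro member_le_sum phi_slope_bounds) auto
      then show ?thesis
        using A p by (simp add: sum_diff1)
    qed
    then show ?thesis
      by (intro tendsto_sandwich[OF _ _ tendsto_const rest] always_eventually allI)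
        (simp_all add: phi_slope_bounds)
  qed
qed

text \<open>
  If all limits over \<open>A \<inter> I\<close> were negative, they would be bounded above by some \<open>d < 0\<close>. The
  averages, whose mass concentrates on \<open>A \<inter> I\<close>, would then have an upper limit of at most \<open>d\<close>.
\<close>

lemma nonneg_limit_of_vanishing_average:
  fixes w C :: "'i \<Rightarrow> 'j \<Rightarrow> real"
  assumes "F \<noteq> bot" and A: "finite A"
    and w: "\<And>i j. 0 \<le> w i j" "\<And>i j. w i j \<le> 1"
    and mass: "((\<lambda>j. \<Sum>i\<in>A. w i j) \<longlongrightarrow> 1) F"
    and outside: "\<And>i. i \<in> A - I \<Longrightarrow> (w i \<longlongrightarrow> 0) F"
    and C: "\<And>i. i \<in> A \<Longrightarrow> (C i \<longlongrightarrow> c i) F"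
    and average: "((\<lambda>j. \<Sum>i\<in>A. w i j * C i j) \<longlongrightarrow> 0) F"
  shows "\<exists>i\<in>A \<inter> I. 0 \<le> c i"
proof (rule ccontr)
  assume "\<not> ?thesis"
  then have neg: "c i < 0" if "i \<in> A \<inter> I" for i
    using that by (meson not_le)
  \<comment> \<open>The value \<open>- 1\<close> keeps the set nonempty when \<open>A\<close> and \<open>I\<close> are disjoint.\<close>
  define d where "d = Max (insert (- 1) (c ` (A \<inter> I)))"
  have "d < 0"
    unfolding d_def using A neg by (subst Max_less_iff) auto
  have d: "c i \<le> d" if "i \<in> A \<inter> I" for i
    unfolding d_def using A that by (intro Max_ge) auto
  have split: "(\<Sum>i\<in>A. g i) - (\<Sum>i\<in>A - I. g i) = (\<Sum>i\<in>A \<inter> I. g i)" for g :: "'i \<Rightarrow> real"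
    using sum.Int_Diff[OF A, of g I] by simp

  have "((\<lambda>j. (\<Sum>i\<in>A. w i j) - (\<Sum>i\<in>A - I. w i j)) \<longlongrightarrow> 1 - (\<Sum>i\<in>A - I. 0)) F"
    by (intro tendsto_diff tendsto_sum mass outside)
  then have mass_I: "((\<lambda>j. \<Sum>i\<in>A \<inter> I. w i j) \<longlongrightarrow> 1) F"
    by (simp add: split)

  have replace: "((\<lambda>j. w i j * (C i j - c i)) \<longlongrightarrow> 0) F" if "i \<in> A" for i
  proof (rule Lim_null_comparison)
    show "((\<lambda>j. norm (C i j - c i)) \<longlongrightarrow> 0) F"
      by (intro tendsto_norm_zero LIM_zero C that)
    show "\<forall>\<^sub>F j in F. norm (w i j * (C i j - c i)) \<le> norm (C i j - c i)"
      using w by (intro always_eventually allI) (simp add: abs_mult mult_left_le_one_le)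
  qed
  have drop: "((\<lambda>j. w i j * c i) \<longlongrightarrow> 0) F" if "i \<in> A - I" for i
    using tendsto_mult_left_zero[OF outside[OF that]] .
  have "((\<lambda>j. (\<Sum>i\<in>A. w i j * C i j) - (\<Sum>i\<in>A. w i j * (C i j - c i)) - (\<Sum>i\<in>A - I. w i j * c i))
      \<longlongrightarrow> 0 - (\<Sum>i\<in>A. 0) - (\<Sum>i\<in>A - I. 0)) F"
    by (intro tendsto_diff tendsto_sum average replace drop)
  then have average_I: "((\<lambda>j. \<Sum>i\<in>A \<inter> I. w i j * c i) \<longlongrightarrow> 0) F"
    by (simp add: split right_diff_distrib sum_subtractf)

  have "(\<Sum>i\<in>A \<inter> I. w i j * c i) \<le> d * (\<Sum>i\<in>A \<inter> I. w i j)" for j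
    unfolding sum_distrib_left
    using d w by (intro sum_mono) (metis mult.commute mult_left_mono)
  then have "0 \<le> d * 1"
    by (intro tendsto_le[OF \<open>F \<noteq> bot\<close> tendsto_mult[OF tendsto_const mass_I] average_I])
      (simp add: always_eventually)
  with \<open>d < 0\<close> show False
    by simp
qed

section \<open>The generalized directional derivative of a finite maximum\<close>

text \<open>
  The maximum dominates each of its members and agrees with an active one at \<open>x\<close>, so its difference
  quotients at the fixed base point \<open>x\<close> dominate those of the active member. Freezing the base point
  can only lower the upper limit.
\<close>

lemma active_slope_le_clarke_dd:
  fixes f :: "'i \<Rightarrow> 'a::euclidean_space \<Rightarrow> real"
  assumes "finite A" "i \<in> A" "f i differentiable (at x)"
    and active: "f i x = (MAX k\<in>A. f k x)"
  shows "ereal (grad (f i) x \<bullet> v) \<le> clarke_dd (\<lambda>y. MAX k\<in>A. f k y) x v"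
proof -
  let ?M = "\<lambda>y. MAX k\<in>A. f k y"
  let ?q = "\<lambda>g (y, s). ereal ((g (y + s *\<^sub>R v) - g y) / s)"
  have "((\<lambda>s. f i (x + s *\<^sub>R v)) has_derivative (\<lambda>h. (h *\<^sub>R v) \<bullet> grad (f i) x)) (at 0)"
  proof (rule has_derivative_compose[where f = "\<lambda>s. x + s *\<^sub>R v" and g = "f i"])
    show "((\<lambda>s. x + s *\<^sub>R v) has_derivative (\<lambda>h. h *\<^sub>R v)) (at 0)"
      by (auto intro!: derivative_eq_intros)
    show "(f i has_derivative (\<lambda>h. h \<bullet> grad (f i) x)) (at (x + 0 *\<^sub>R v))"
      using GDERIV_grad[OF assms(3)] by (simp add: gderiv_def)
  qed
  then have "((\<lambda>s. f i (x + s *\<^sub>R v)) has_real_derivative grad (f i) x \<bullet> v) (at 0)"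
    unfolding has_field_derivative_def
    by (rule has_derivative_eq_rhs) (simp add: fun_eq_iff inner_commute)
  then have "((\<lambda>s. (f i (x + s *\<^sub>R v) - f i x) / s) \<longlongrightarrow> grad (f i) x \<bullet> v) (at_right 0)"
    unfolding DERIV_def by (simp add: filterlim_at_split)
  then have "ereal (grad (f i) x \<bullet> v) = Limsup (at_right 0) (\<lambda>s. ?q (f i) (x, s))"
    unfolding prod.case
    by (intro lim_imp_Limsup[symmetric] tendsto_ereal trivial_limit_at_right_real)
  also have "\<dots> \<le> Limsup (at_right 0) (\<lambda>s. ?q ?M (x, s))"
  proof (rule Limsup_mono)
    have "f i y \<le> ?M y" for y
      using assms(1,2) by simp
    then have "?q (f i) (x, s) \<le> ?q ?M (x, s)" if "s > 0" for s
      using that active by (simp add: divide_right_mono)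
    then show "\<forall>\<^sub>F s in at_right 0. ?q (f i) (x, s) \<le> ?q ?M (x, s)"
      by (rule eventually_mono[OF eventually_at_right_less])
  qed
  also have "\<dots> \<le> Limsup (filtermap (Pair x) (at_right 0)) (?q ?M)"
    by (rule Limsup_filtermap_ge)
  also have "\<dots> \<le> clarke_dd ?M x v"
    unfolding clarke_dd_def Limsup_def
  proof (rule INF_superset_mono[OF _ order_refl])
    have "filterlim (Pair x) (nhds x \<times>\<^sub>F at_right 0) (at_right 0)"
      by (intro filterlim_Pair tendsto_const filterlim_ident)
    then show "{P. eventually P (nhds x \<times>\<^sub>F at_right 0)}
        \<subseteq> {P. eventually P (filtermap (Pair x) (at_right 0))}"
      by (auto simp: filterlim_def le_filter_def)
  qed
  finally show ?thesis .
qed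

section \<open>Accumulation points of nearly stationary points\<close>

text \<open>
  Intersecting the tails of the sequence with the preimages of the neighbourhoods of an accumulation
  point gives a proper filter along which the whole sequence converges; it plays the role of a
  convergent subsequence.
\<close>

lemma accumulation_point_filter:
  assumes "accumulation_point z a"
  obtains F where "F \<noteq> bot" "F \<le> sequentially" "(z \<longlongrightarrow> a) F"
proof
  let ?F = "inf sequentially (filtercomap z (nhds a))"
  show "?F \<le> sequentially"
    by simp
  show "(z \<longlongrightarrow> a) ?F"
    by (rule filterlim_mono[OF filterlim_filtercomap order_refl]) simp
  show "?F \<noteq> bot"
  proof
    assume "?F = bot"
    then have "eventually (\<lambda>_. False) ?F"
      by simp
    then obtain P Q where P: "eventually P sequentially"
      and Q: "eventually Q (filtercomap z (nhds a))" and PQ: "\<And>j. P j \<Longrightarrow> Q j \<Longrightarrow> False"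
      unfolding eventually_inf by blast
    from Q obtain U where "open U" "a \<in> U" and U: "\<And>j. z j \<in> U \<Longrightarrow> Q j"
      unfolding eventually_filtercomap eventually_nhds by metis
    then have "\<exists>\<^sub>F j in sequentially. z j \<in> U"
      using assms by (simp add: accumulation_point_def)
    moreover have "\<forall>\<^sub>F j in sequentially. z j \<notin> U"
      using P by (rule eventually_mono) (use PQ U in blast)
    ultimately show False
      by (simp add: frequently_def)
  qed
qed

theorem theorem8p2:
  fixes f :: "nat \<Rightarrow> real ^ 'n \<Rightarrow> real" and m :: nat and L :: "nat \<Rightarrow> real"
    and \<tau> \<epsilon> :: "nat \<Rightarrow> real"
    and z :: "nat \<Rightarrow> (real ^ 'n) \<times> real"
    and x_star :: "real ^ 'n" and t_star :: real
  assumes "m \<ge> 1"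
    and "\<And>i. i \<in> {1..m} \<Longrightarrow> C1_fun (f i)"
    and "\<And>i. i \<in> {1..m} \<Longrightarrow> (L i)-lipschitz_on UNIV (grad (f i))"
    and "\<And>j. \<tau> j > 0" and "\<tau> \<longlonglongrightarrow> 0"
    and "\<epsilon> \<longlonglongrightarrow> 0"
    and "\<And>j. norm (grad (Phi m f (\<tau> j)) (z j)) \<le> \<epsilon> j"
    and "accumulation_point z (x_star, t_star)"
  shows "0 \<in> clarke_subdiff (\<lambda>x. MAX i\<in>{1..m}. f i x) x_star"
proof -
  let ?A = "{1..m}"
  define x t where "x = (\<lambda>j. fst (z j))" and "t = (\<lambda>j. snd (z j))"
  define w where "w = (\<lambda>i j. phi_slope (\<tau> j) (f i (x j) - t j))"
  define I where "I = {i. f i x_star = (MAX k\<in>?A. f k x_star)}"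
  have diff: "f i differentiable (at y)" if "i \<in> ?A" for i y
    using assms(2)[OF that] by (simp add: C1_fun_def)
  obtain F where F: "F \<noteq> bot" "F \<le> sequentially" and z: "(z \<longlongrightarrow> (x_star, t_star)) F"
    using accumulation_point_filter[OF assms(8)] .
  have x: "(x \<longlongrightarrow> x_star) F" and t: "(t \<longlongrightarrow> t_star) F"
    using tendsto_fst[OF z] tendsto_snd[OF z] by (simp_all add: x_def t_def)
  have \<tau>: "(\<tau> \<longlongrightarrow> 0) F"
    using assms(5) F(2) by (rule tendsto_mono[rotated])
  have fx: "((\<lambda>j. f i (x j)) \<longlongrightarrow> f i x_star) F" if "i \<in> ?A" for i
    using differentiable_imp_continuous_within[OF diff[OF that]] x by (rule isCont_tendsto_compose)
  have grad_x: "((\<lambda>j. grad (f i) (x j)) \<longlongrightarrow> grad (f i) x_star) F" if "i \<in> ?A" for i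
    using assms(2)[OF that] x
    by (auto simp: C1_fun_def continuous_on_eq_continuous_at intro: isCont_tendsto_compose)

  have grad_Phi: "grad (Phi m f (\<tau> j)) (z j) = (\<Sum>i\<in>?A. w i j *\<^sub>R grad (f i) (x j), 1 - (\<Sum>i\<in>?A. w i j))"
    for j
    using grad_eq[OF GDERIV_Phi[where m = m and f = f and \<tau> = "\<tau> j" and x = "x j" and t = "t j"]]
      diff assms(4)[of j]
    by (simp add: w_def x_def t_def)
  have "((\<lambda>j. grad (Phi m f (\<tau> j)) (z j)) \<longlongrightarrow> 0) F"
    by (rule tendsto_mono[OF F(2)], rule Lim_null_comparison[OF _ assms(6)])
      (simp add: assms(7))
  from tendsto_fst[OF this] tendsto_snd[OF this]
  have combination: "((\<lambda>j. \<Sum>i\<in>?A. w i j *\<^sub>R grad (f i) (x j)) \<longlongrightarrow> 0) F"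
    and "((\<lambda>j. 1 - (\<Sum>i\<in>?A. w i j)) \<longlongrightarrow> 0) F"
    by (simp_all add: grad_Phi)
  from tendsto_diff[OF tendsto_const[of 1] this(2)]
  have mass: "((\<lambda>j. \<Sum>i\<in>?A. w i j) \<longlongrightarrow> 1) F"
    by simp
  have inactive: "(w i \<longlongrightarrow> 0) F" if i: "i \<in> ?A - I" for i
    unfolding w_def
  proof (rule inactive_weight_tendsto_0[where A = ?A and a = "\<lambda>i. f i x_star" and b = t_star])
    show "((\<lambda>j. f k (x j) - t j) \<longlongrightarrow> f k x_star - t_star) F" if "k \<in> ?A" for k
      using fx[OF that] t by (rule tendsto_diff)
    have "f i x_star \<le> (MAX k\<in>?A. f k x_star)"
      using i by (intro Max_ge) auto
    moreover have "f i x_star \<noteq> (MAX k\<in>?A. f k x_star)"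
      using i by (simp add: I_def)
    ultimately show "f i x_star < (MAX k\<in>?A. f k x_star)"
      by (rule le_neq_trans)
  qed (use F \<tau> mass i in \<open>simp_all add: w_def\<close>)

  have "0 \<le> clarke_dd (\<lambda>y. MAX i\<in>?A. f i y) x_star v" for v
  proof -
    have average: "((\<lambda>j. \<Sum>i\<in>?A. w i j * (grad (f i) (x j) \<bullet> v)) \<longlongrightarrow> 0) F"
      using tendsto_inner[OF combination tendsto_const[of v]] by (simp add: inner_sum_left)
    have "\<exists>i\<in>?A \<inter> I. 0 \<le> grad (f i) x_star \<bullet> v"
      by (rule nonneg_limit_of_vanishing_average[OF F(1) _ _ _ mass inactive _ average])
        (auto simp: w_def phi_slope_bounds intro!: tendsto_inner grad_x)
    then obtain i where i: "i \<in> ?A" "i \<in> I" and nonneg: "0 \<le> grad (f i) x_star \<bullet> v"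
      by blast
    have "0 \<le> ereal (grad (f i) x_star \<bullet> v)"
      using nonneg by simp
    also have "\<dots> \<le> clarke_dd (\<lambda>y. MAX i\<in>?A. f i y) x_star v"
      using i diff by (intro active_slope_le_clarke_dd) (auto simp: I_def)
    finally show ?thesis .
  qed
  then show ?thesis
    by (simp add: clarke_subdiff_def zero_ereal_def)
qed

end
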